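(* Consider the generalized system $$u_{xt}+uu_{xx}=\lambda u_x^2-\lambda b_x^2+\kappa bb_{xx}+I(t),\qquad b_t+ub_x=\kappa bu_x,\qquad u_t+uu_x=-p_x+bb_x,$$ $$I(t)=(\lambda+\kappa)\|b_x(\cdot,t)\|_{L^2([0,1])}^2-(\lambda+1)\|u_x(\cdot,t)\|_{L^2([0,1])}^2,$$ for $0\le x\le1$, with smooth initial data $(u(x,0),b(x,0))=(u_0(x),b_0(x))$ and either the Dirichlet or the periodic boundary condition. Let $\gamma$ denote the associated Lagrangian trajectories. Suppose there is $\alpha_0\in[0,1]$ such that $b_0(\alpha_0)=0$ and $b_0'(\alpha_0)>0$, and that the nontrivial initial data satisfies the smallness condition $$\|u_0'\|_{L^2([0,1])}^2+\|b_0'\|_{L^2([0,1])}^2\le1.$$ Then, for $(\lambda,\kappa)=(-1/2,0)$, neither $u_x(\gamma(\alpha_0,t),t)$ nor $b_x(\gamma(\alpha_0,t),t)$ blows up in finite time.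
   Context: $(u,b)$ is the solution with initial data $(u_0,b_0)$ ($p$ is the associated pressure). The Dirichlet boundary condition is $u(0,t)=u(1,t)=0$, $b(0,t)=b(1,t)=0$. The periodic boundary condition is $u(0,t)=u(1,t)$, $u_x(0,t)=u_x(1,t)$, $b(0,t)=b(1,t)$, $b_x(0,t)=b_x(1,t)$. The Lagrangian trajectories $\gamma(\alpha,t)$ are defined by $\gamma_t(\alpha,t)=u(\gamma(\alpha,t),t)$, $\gamma(\alpha,0)=\alpha$, for $\alpha\in[0,1]$. *)

theory Defs
  imports "HOL-Analysis.Analysis"
begin

(* Functions of (x,t) are curried, f x t, and are only meaningful for x in [0,1] and t in [0,T).
   All derivatives are taken within [0,1] in space and within [0,infinity) in time, so that they
   are the one-sided ones at x = 0, x = 1 and t = 0. *)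

definition deriv01 :: "(real \<Rightarrow> real) \<Rightarrow> real \<Rightarrow> real" where
  "deriv01 f x = vector_derivative f (at x within {0..1})"

definition dx :: "(real \<Rightarrow> real \<Rightarrow> real) \<Rightarrow> real \<Rightarrow> real \<Rightarrow> real" where
  "dx f x t = deriv01 (\<lambda>y. f y t) x"

definition dt :: "(real \<Rightarrow> real \<Rightarrow> real) \<Rightarrow> real \<Rightarrow> real \<Rightarrow> real" where
  "dt f x t = vector_derivative (\<lambda>s. f x s) (at t within {0..})"

definition L2_norm :: "(real \<Rightarrow> real) \<Rightarrow> real" where
  "L2_norm f = sqrt (LINT x:{0..1}|lborel. (f x)\<^sup>2)"

definition smooth01 :: "(real \<Rightarrow> real) \<Rightarrow> bool" where
  "smooth01 f \<longleftrightarrow>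
     (\<forall>n::nat. \<forall>x\<in>{0..1}. ((deriv01 ^^ n) f) differentiable (at x within {0..1}))"

(* The interval [0,T) with 0 < T \<le> \<infinity>. *)
definition times :: "ereal \<Rightarrow> real set" where
  "times T = {t. 0 \<le> t \<and> ereal t < T}"

(* f, f_x, f_t, f_xx, f_xt exist and are continuous on [0,1] x [0,T). *)
definition classical :: "ereal \<Rightarrow> (real \<Rightarrow> real \<Rightarrow> real) \<Rightarrow> bool" where
  "classical T f \<longleftrightarrow>
     (\<forall>x\<in>{0..1}. \<forall>t\<in>times T.
        (\<lambda>y. f y t) differentiable (at x within {0..1}) \<and>
        (\<lambda>s. f x s) differentiable (at t within {0..}) \<and>
        (\<lambda>y. dx f y t) differentiable (at x within {0..1}) \<and>
        (\<lambda>s. dx f x s) differentiable (at t within {0..})) \<and>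
     (\<forall>g\<in>{f, dx f, dt f, dx (dx f), dt (dx f)}.
        continuous_on ({0..1} \<times> times T) (\<lambda>(x, t). g x t))"

datatype boundary = Dirichlet | Periodic

fun boundary_condition ::
  "boundary \<Rightarrow> ereal \<Rightarrow> (real \<Rightarrow> real \<Rightarrow> real) \<Rightarrow> (real \<Rightarrow> real \<Rightarrow> real) \<Rightarrow> bool" where
  "boundary_condition Dirichlet T u b \<longleftrightarrow>
     (\<forall>t\<in>times T. u 0 t = 0 \<and> u 1 t = 0 \<and> b 0 t = 0 \<and> b 1 t = 0)"
| "boundary_condition Periodic T u b \<longleftrightarrow>
     (\<forall>t\<in>times T. u 0 t = u 1 t \<and> dx u 0 t = dx u 1 t \<and> b 0 t = b 1 t \<and> dx b 0 t = dx b 1 t)"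

definition I_term ::
  "real \<Rightarrow> real \<Rightarrow> (real \<Rightarrow> real \<Rightarrow> real) \<Rightarrow> (real \<Rightarrow> real \<Rightarrow> real) \<Rightarrow> real \<Rightarrow> real" where
  "I_term lam kap u b t =
     (lam + kap) * (L2_norm (\<lambda>x. dx b x t))\<^sup>2 - (lam + 1) * (L2_norm (\<lambda>x. dx u x t))\<^sup>2"

(* u_xt is the time derivative of u_x.  No boundary condition is imposed on the pressure p. *)
definition solution ::
  "real \<Rightarrow> real \<Rightarrow> boundary \<Rightarrow> ereal \<Rightarrow> (real \<Rightarrow> real) \<Rightarrow> (real \<Rightarrow> real) \<Rightarrow>
   (real \<Rightarrow> real \<Rightarrow> real) \<Rightarrow> (real \<Rightarrow> real \<Rightarrow> real) \<Rightarrow> (real \<Rightarrow> real \<Rightarrow> real) \<Rightarrow> bool" where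
  "solution lam kap bc T u0 b0 u b p \<longleftrightarrow>
     classical T u \<and> classical T b \<and>
     (\<forall>x\<in>{0..1}. \<forall>t\<in>times T. (\<lambda>y. p y t) differentiable (at x within {0..1})) \<and>
     (\<forall>x\<in>{0..1}. \<forall>t\<in>times T.
        dt (dx u) x t + u x t * dx (dx u) x t =
          lam * (dx u x t)\<^sup>2 - lam * (dx b x t)\<^sup>2 + kap * b x t * dx (dx b) x t
          + I_term lam kap u b t \<and>
        dt b x t + u x t * dx b x t = kap * b x t * dx u x t \<and>
        dt u x t + u x t * dx u x t = - dx p x t + b x t * dx b x t) \<and>
     boundary_condition bc T u b \<and>
     (\<forall>x\<in>{0..1}. u x 0 = u0 x \<and> b x 0 = b0 x)"

(* Under the periodic boundary condition a trajectory may leave [0,1], and f(.,t) is then evaluated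
   through its 1-periodic extension; under the Dirichlet condition trajectories stay in [0,1]. *)
fun value_at :: "boundary \<Rightarrow> (real \<Rightarrow> real \<Rightarrow> real) \<Rightarrow> real \<Rightarrow> real \<Rightarrow> real" where
  "value_at Dirichlet f x t = f x t"
| "value_at Periodic f x t = f (frac x) t"

definition lagrangian_trajectories ::
  "boundary \<Rightarrow> ereal \<Rightarrow> (real \<Rightarrow> real \<Rightarrow> real) \<Rightarrow> (real \<Rightarrow> real \<Rightarrow> real) \<Rightarrow> bool" where
  "lagrangian_trajectories bc T u \<gamma> \<longleftrightarrow>
     (\<forall>\<alpha>\<in>{0..1}. \<gamma> \<alpha> 0 = \<alpha> \<and>
        (\<forall>t\<in>times T.
           (bc = Dirichlet \<longrightarrow> \<gamma> \<alpha> t \<in> {0..1}) \<and>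
           (\<gamma> \<alpha> has_real_derivative value_at bc u (\<gamma> \<alpha> t) t) (at t within {0..})))"

(* f : [0,T) \<rightarrow> \<real> is unbounded on approach to some finite time t* \<le> T. *)
definition blows_up_in_finite_time :: "ereal \<Rightarrow> (real \<Rightarrow> real) \<Rightarrow> bool" where
  "blows_up_in_finite_time T f \<longleftrightarrow>
     (\<exists>ts>0. ereal ts \<le> T \<and> Limsup (at_left ts) (\<lambda>t. ereal \<bar>f t\<bar>) = \<infinity>)"

end

theory Submission
  imports Defs
begin

text \<open>
  For these parameters \<open>b\<close> is merely transported by the flow, and the nonlocal term is
  \<open>I = - E / 2\<close>, where \<open>E = \<parallel>u\<^sub>x\<parallel>\<^sup>2 + \<parallel>b\<^sub>x\<parallel>\<^sup>2\<close> is the energy. The energy is conserved: its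
  density changes by the \<open>x\<close>-derivative of
  \<open>- u (u\<^sub>x\<^sup>2 + b\<^sub>x\<^sup>2) - E u\<close>, whose boundary values cancel (\<open>energy_conserved\<close>). Hence, along any
  trajectory, \<open>U = u\<^sub>x\<close> and \<open>B = b\<^sub>x\<close> solve a closed autonomous system,
  \<open>U' = (B\<^sup>2 - U\<^sup>2 - E) / 2\<close> and \<open>B' = - U B\<close>, with a constant \<open>E \<ge> 0\<close>.

  In terms of \<open>z = U + i B\<close> this is the Riccati equation \<open>z' = - (z\<^sup>2 + E) / 2\<close>, a flow by isometries
  of the hyperbolic upper half plane, so an orbit that starts with \<open>B > 0\<close> cannot escape. The
  quantitative form of this is a first integral: \<open>W = U\<^sup>2 + B\<^sup>2 + E\<close> satisfies \<open>W' = - U W\<close>, the same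
  linear equation as \<open>B\<close>, so \<open>W / B\<close> keeps its initial value \<open>C\<close>. Then \<open>U\<^sup>2 + B\<^sup>2 \<le> C B\<close> confines
  \<open>(U, B)\<close> to a disc (\<open>trajectory_bound\<close>), uniformly in time.

  Two points need care. Neither \<open>b\<^sub>t\<^sub>x\<close> nor the equation for \<open>b\<^sub>x\<close> is given; both come from
  interchanging derivatives (\<open>mixed_partials_commute\<close>). And a trajectory of the periodic problem may
  cross the integers, where the periodic extensions of \<open>u\<^sub>x\<close> and \<open>b\<^sub>x\<close> may have a corner;
  \<open>material_derivative\<close> shows that they are differentiable along the flow all the same.
\<close>

section \<open>Calculus on a space-time rectangle\<close>

text \<open>
  The existence of \<open>f\<^sub>t\<^sub>x\<close> is a conclusion here, so the symmetry of second derivatives does not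
  apply. Instead, differentiating \<open>f y s = f 0 s + \<integral> f\<^sub>x\<close> in time under the integral represents
  \<open>f\<^sub>t\<close> as a primitive of \<open>f\<^sub>x\<^sub>t\<close>.
\<close>

lemma mixed_partials_commute:
  fixes f fx ft fxt :: "real \<Rightarrow> real \<Rightarrow> real" and \<tau> :: real
  assumes "0 < \<tau>"
    and fx: "\<And>x t. x \<in> {0..1} \<Longrightarrow> t \<in> {0..\<tau>} \<Longrightarrow>
          ((\<lambda>y. f y t) has_real_derivative fx x t) (at x within {0..1})"
    and ft: "\<And>x t. x \<in> {0..1} \<Longrightarrow> t \<in> {0..\<tau>} \<Longrightarrow>
          (f x has_real_derivative ft x t) (at t within {0..\<tau>})"
    and fxt: "\<And>x t. x \<in> {0..1} \<Longrightarrow> t \<in> {0..\<tau>} \<Longrightarrow>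
          (fx x has_real_derivative fxt x t) (at t within {0..\<tau>})"
    and cfx: "continuous_on ({0..1} \<times> {0..\<tau>}) (\<lambda>(x, t). fx x t)"
    and cfxt: "continuous_on ({0..1} \<times> {0..\<tau>}) (\<lambda>(x, t). fxt x t)"
    and x: "x \<in> {0..1}" and t: "t \<in> {0..\<tau>}"
  shows "((\<lambda>y. ft y t) has_real_derivative fxt x t) (at x within {0..1})"
proof -
  have slice_fx: "continuous_on {0..1} (\<lambda>y. fx y s)" if "s \<in> {0..\<tau>}" for s
    by (rule continuous_on_compose2[OF cfx, where f = "\<lambda>y. (y, s)", simplified])
      (use that in \<open>auto intro!: continuous_intros\<close>)
  have slice_fxt: "continuous_on {0..1} (\<lambda>y. fxt y t)"
    by (rule continuous_on_compose2[OF cfxt, where f = "\<lambda>y. (y, t)", simplified])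
      (use t in \<open>auto intro!: continuous_intros\<close>)
  have ft_eq: "ft y t = ft 0 t + integral {0..y} (\<lambda>z. fxt z t)" if y: "y \<in> {0..1}" for y
  proof -
    have FTC: "f y s = f 0 s + integral {0..y} (\<lambda>z. fx z s)" if s: "s \<in> {0..\<tau>}" for s
    proof -
      have "((\<lambda>z. fx z s) has_integral (f y s - f 0 s)) {0..y}"
        using y
        by (intro fundamental_theorem_of_calculus)
          (auto simp: has_real_derivative_iff_has_vector_derivative[symmetric]
            intro!: has_field_derivative_subset[OF fx[OF _ s]])
      then show ?thesis by (simp add: integral_unique)
    qed
    have swap: "continuous_on ({0..\<tau>} \<times> cbox 0 y) (\<lambda>(s, z). fxt z s)"
      unfolding split_beta
      by (rule continuous_on_compose2[OF cfxt, where f = "\<lambda>p. (snd p, fst p)", simplified])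
        (use y in \<open>auto intro!: continuous_intros\<close>)
    have "((\<lambda>s. integral (cbox 0 y) (\<lambda>z. fx z s)) has_real_derivative
        integral (cbox 0 y) (\<lambda>z. fxt z t)) (at t within {0..\<tau>})"
    proof (rule leibniz_rule_field_derivative[OF _ _ swap t])
      fix s z assume "s \<in> {0..\<tau>}" "z \<in> cbox 0 y"
      then show "((\<lambda>s. fx z s) has_real_derivative fxt z s) (at s within {0..\<tau>})"
        using fxt[of z s] y by simp
    next
      fix s assume "s \<in> {0..\<tau>}"
      then show "(\<lambda>z. fx z s) integrable_on cbox 0 y"
        using continuous_on_subset[OF slice_fx[of s], of "{0..y}"] y
        by (simp add: integrable_continuous_real)
    qed auto
    then have "((\<lambda>s. f 0 s + integral {0..y} (\<lambda>z. fx z s)) has_real_derivative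
        ft 0 t + integral {0..y} (\<lambda>z. fxt z t)) (at t within {0..\<tau>})"
      using ft[of 0 t] t by (auto intro!: DERIV_add)
    then have "(f y has_real_derivative ft 0 t + integral {0..y} (\<lambda>z. fxt z t))
        (at t within {0..\<tau>})"
      by (rule has_field_derivative_transform_within[where d = 1]) (use t FTC in auto)
    moreover have "at t within {0..\<tau>} \<noteq> bot"
      using t \<open>0 < \<tau>\<close> by (simp add: trivial_limit_within)
    ultimately show ?thesis
      using ft[OF y t] has_field_derivative_unique by blast
  qed
  have "((\<lambda>y. ft 0 t + integral {0..y} (\<lambda>z. fxt z t)) has_real_derivative fxt x t)
      (at x within {0..1})"
    using integral_has_real_derivative[OF slice_fxt x] by (auto intro!: derivative_eq_intros)
  then show ?thesis
    by (rule has_field_derivative_transform_within[OF _ zero_less_one x ft_eq[symmetric]])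
qed

text \<open>
  At an integer \<open>x\<close> two shifts \<open>k\<close> are admissible, one for each neighbouring period cell.
\<close>

lemma value_at_periodic:
  assumes "F 0 t = F 1 t" and "x - of_int k \<in> {0..1}"
  shows "value_at Periodic F x t = F (x - of_int k) t"
proof (cases "x - of_int k = 1")
  case True
  then have "x = of_int (k + 1)" by simp
  then have "frac x = 0" by (simp only: frac_of_int)
  then show ?thesis using True assms(1) by (simp del: frac_eq_0_iff)
next
  case False
  then have "frac x = x - of_int k"
    using assms(2) by (subst frac_unique_iff) auto
  then show ?thesis by simp
qed

lemma DERIV_within_eventually:
  assumes "(f has_real_derivative D) (at t within S)" and "\<forall>\<^sub>F s in at t within A. s \<in> S"
  shows "(f has_real_derivative D) (at t within A)"
proof -
  have "at t within A \<le> at t within S"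
  proof -
    have "\<forall>\<^sub>F s in at t within A. s \<noteq> t"
      by (simp add: eventually_at_filter)
    with assms(2) have "\<forall>\<^sub>F s in at t within A. s \<in> S - {t}"
      by eventually_elim simp
    then show ?thesis
      unfolding at_within_def[of t S] by (intro le_infI at_within_le_nhds) (simp add: le_principal)
  qed
  then show ?thesis
    using assms(1) unfolding has_field_derivative_iff by (rule tendsto_mono)
qed

lemma DERIV_within_Un:
  assumes "(f has_real_derivative D) (at t within S)" "(f has_real_derivative D) (at t within S')"
  shows "(f has_real_derivative D) (at t within S \<union> S')"
  using assms unfolding has_field_derivative_iff by (simp add: Lim_within_Un)

text \<open>
  The chain rule along a trajectory, for a field that is differentiable on one period cell only.
  While the trajectory stays in the cell \<open>[k, k + 1]\<close>, the composition is a differentiable function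
  on a subset of the time interval, with derivative \<open>D = F\<^sub>t + u F\<^sub>x\<close>. At an integer
  the times before and after a crossing belong to different cells, and there the one-sided values
  of \<open>F\<^sub>x\<close> may differ. Only the two values of \<open>D\<close> have to agree for the pieces to fit together, and
  for a solution they do, because \<open>D\<close> is determined by \<open>u\<^sub>x\<close>, \<open>b\<^sub>x\<close> and \<open>E\<close> through the equations.
\<close>

lemma material_derivative:
  fixes F Fx Ft u D :: "real \<Rightarrow> real \<Rightarrow> real" and g :: "real \<Rightarrow> real"
  assumes t: "t \<in> {0..\<tau>}"
    and Fx: "\<And>x. x \<in> {0..1} \<Longrightarrow>
          ((\<lambda>y. F y t) has_real_derivative Fx x t) (at x within {0..1})"
    and Ft: "\<And>x s. x \<in> {0..1} \<Longrightarrow> s \<in> {0..\<tau>} \<Longrightarrow>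
          (F x has_real_derivative Ft x s) (at s within {0..\<tau>})"
    and cFt: "continuous_on ({0..1} \<times> {0..\<tau>}) (\<lambda>(x, s). Ft x s)"
    and D: "\<And>x. x \<in> {0..1} \<Longrightarrow> D x t = Ft x t + u x t * Fx x t"
    and g: "(g has_real_derivative value_at bc u (g t) t) (at t within {0..\<tau>})"
    and dir: "\<And>s. bc = Dirichlet \<Longrightarrow> s \<in> {0..\<tau>} \<Longrightarrow> g s \<in> {0..1}"
    and perF: "\<And>s. bc = Periodic \<Longrightarrow> s \<in> {0..\<tau>} \<Longrightarrow> F 0 s = F 1 s"
    and peru: "bc = Periodic \<Longrightarrow> u 0 t = u 1 t"
    and perD: "bc = Periodic \<Longrightarrow> D 0 t = D 1 t"
  shows "((\<lambda>s. value_at bc F (g s) s) has_real_derivative value_at bc D (g t) t)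
           (at t within {0..\<tau>})"
proof -
  have joint: "((\<lambda>(x, s). F x s) has_derivative (\<lambda>(h, k). Fx x t * h + Ft x t * k))
      (at (x, t) within {0..1} \<times> {0..\<tau>})" if x: "x \<in> {0..1}" for x
  proof -
    have "((\<lambda>(x, s). F x s) has_derivative
        (\<lambda>(h, k). Fx x t * h + blinfun_apply (blinfun_mult_right (Ft x t)) k))
        (at (x, t) within {0..1} \<times> {0..\<tau>})"
    proof (rule has_derivative_partialsI[where fy = "\<lambda>x s. blinfun_mult_right (Ft x s)"])
      show "((\<lambda>x. F x t) has_derivative (*) (Fx x t)) (at x within {0..1})"
        using Fx[OF x] by (simp add: has_field_derivative_def)
      show "((\<lambda>s. F y s) has_derivative blinfun_apply (blinfun_mult_right (Ft y s)))
          (at s within {0..\<tau>})" if "y \<in> {0..1}" "s \<in> {0..\<tau>}" for y s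
        using Ft[OF that] by (simp add: has_field_derivative_def)
      have "continuous_on ({0..1} \<times> {0..\<tau>}) (\<lambda>(x, s). blinfun_mult_right (Ft x s))"
        using cFt unfolding split_beta by (intro continuous_intros)
      then show "continuous (at (x, t) within {0..1} \<times> {0..\<tau>})
          (\<lambda>(x, s). blinfun_mult_right (Ft x s))"
        using x t by (simp add: continuous_on_eq_continuous_within)
    qed (use t in auto)
    then show ?thesis by simp
  qed
  \<comment> \<open>\<open>c\<close> is the left end of a cell that contains \<open>g t\<close>, possibly at its edge.\<close>
  have branch: "((\<lambda>s. F (g s - c) s) has_real_derivative D (g t - c) t)
      (at t within {s \<in> {0..\<tau>}. g s - c \<in> {0..1}})"
    if c: "g t - c \<in> {0..1}" "value_at bc u (g t) t = u (g t - c) t" for c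
  proof -
    let ?S = "{s \<in> {0..\<tau>}. g s - c \<in> {0..1}}"
    have "((\<lambda>s. (g s - c, s)) has_derivative (\<lambda>h. (u (g t - c) t * h, h))) (at t within ?S)"
    proof -
      have "(g has_real_derivative u (g t - c) t) (at t within ?S)"
        using g unfolding c(2) by (rule has_field_derivative_subset) auto
      then have "((\<lambda>s. g s - c) has_real_derivative u (g t - c) t) (at t within ?S)"
        by (auto intro!: derivative_eq_intros)
      then show ?thesis
        unfolding has_field_derivative_def by (intro has_derivative_Pair has_derivative_ident)
    qed
    from has_derivative_in_compose[OF this, of "\<lambda>(x, s). F x s",
        OF has_derivative_subset[OF joint[OF c(1)]]]
    have "((\<lambda>s. F (g s - c) s) has_derivative
        (\<lambda>h. Fx (g t - c) t * (u (g t - c) t * h) + Ft (g t - c) t * h)) (at t within ?S)"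
      by (auto simp: image_subset_iff)
    moreover have "(\<lambda>h. Fx (g t - c) t * (u (g t - c) t * h) + Ft (g t - c) t * h)
        = (*) (D (g t - c) t)"
      using D[OF c(1)] by (auto simp: algebra_simps)
    ultimately show ?thesis by (simp add: has_field_derivative_def)
  qed
  show ?thesis
  proof (cases bc)
    case Dirichlet
    have "{s \<in> {0..\<tau>}. g s - 0 \<in> {0..1}} = {0..\<tau>}"
      using dir[OF Dirichlet] by auto
    with branch[of 0] dir[OF Dirichlet t] show ?thesis
      by (simp add: Dirichlet)
  next
    case Periodic
    let ?S = "\<lambda>k. {s \<in> {0..\<tau>}. g s - of_int k \<in> {0..1}}"
    have per_branch: "((\<lambda>s. value_at bc F (g s) s) has_real_derivative value_at bc D (g t) t)
        (at t within ?S k)" if k: "g t - of_int k \<in> {0..1}" for k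
    proof -
      have "((\<lambda>s. F (g s - of_int k) s) has_real_derivative D (g t - of_int k) t)
          (at t within ?S k)"
        using branch[OF k] value_at_periodic[of u t "g t" k] peru k Periodic by simp
      moreover have "value_at bc D (g t) t = D (g t - of_int k) t"
        using value_at_periodic[of D t "g t" k] perD k Periodic by simp
      moreover have "value_at bc F (g s) s = F (g s - of_int k) s" if "s \<in> ?S k" for s
        using value_at_periodic[of F s "g s" k] perF[OF Periodic] that Periodic by simp
      ultimately show ?thesis
        using k t by (auto intro: has_field_derivative_transform_within[where d = 1])
    qed
    have lim: "(g \<longlongrightarrow> g t) (at t within {0..\<tau>})"
      using has_field_derivative_imp_has_derivative[OF g] has_derivative_continuous
      by (metis continuous_within)
    have in_times: "\<forall>\<^sub>F s in at t within {0..\<tau>}. s \<in> {0..\<tau>}"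
      by (simp add: eventually_at_filter)
    define n where "n = \<lfloor>g t\<rfloor>"
    have n: "of_int n \<le> g t" "g t < of_int n + 1" unfolding n_def by linarith+
    have below: "\<forall>\<^sub>F s in at t within {0..\<tau>}. g s < of_int n + 1"
      using order_tendstoD(2)[OF lim n(2)] .
    show ?thesis
    proof (cases "g t = of_int n")
      case False
      with n have "of_int n < g t" by simp
      from order_tendstoD(1)[OF lim this] below in_times
      have "\<forall>\<^sub>F s in at t within {0..\<tau>}. s \<in> ?S n"
        by eventually_elim auto
      then show ?thesis
        using per_branch[of n] n by (auto intro: DERIV_within_eventually)
    next
      case True
      \<comment> \<open>At an integer, nearby times fall into the two cells that meet there.\<close>
      then have "of_int n - 1 < g t" by simp
      from order_tendstoD(1)[OF lim this] below in_times
      have "\<forall>\<^sub>F s in at t within {0..\<tau>}. s \<in> ?S n \<union> ?S (n - 1)"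
        by eventually_elim auto
      moreover have "((\<lambda>s. value_at bc F (g s) s) has_real_derivative value_at bc D (g t) t)
          (at t within ?S n \<union> ?S (n - 1))"
        using True by (intro DERIV_within_Un per_branch) auto
      ultimately show ?thesis by (rule DERIV_within_eventually[rotated])
    qed
  qed
qed

lemma linear_ode_exp:
  fixes f a :: "real \<Rightarrow> real"
  assumes "continuous_on {0..\<tau>} a"
    and f: "\<And>s. s \<in> {0..\<tau>} \<Longrightarrow> (f has_real_derivative a s * f s) (at s within {0..\<tau>})"
    and t: "t \<in> {0..\<tau>}"
  shows "f t = f 0 * exp (integral {0..t} a)"
proof -
  let ?h = "\<lambda>s. f s * exp (- integral {0..s} a)"
  have "(?h has_real_derivative 0) (at s within {0..\<tau>})" if "s \<in> {0..\<tau>}" for s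
    using f[OF that] integral_has_real_derivative[OF assms(1) that]
    by (auto intro!: derivative_eq_intros)
  then obtain c where c: "\<And>s. s \<in> {0..\<tau>} \<Longrightarrow> ?h s = c"
    using has_field_derivative_zero_constant[of "{0..\<tau>}" ?h] by auto
  have "?h t = ?h 0" using c[OF t] c[of 0] t by simp
  then show ?thesis by (simp add: exp_minus field_simps)
qed

section \<open>Energy conservation and the dynamics along a trajectory\<close>

lemma Icc_subset_times:
  assumes "\<tau> \<in> times T"
  shows "{0..\<tau>} \<subseteq> times T"
proof
  fix t assume t: "t \<in> {0..\<tau>}"
  then have "ereal t \<le> ereal \<tau>" by simp
  also have "ereal \<tau> < T" using assms by (simp add: times_def)
  finally show "t \<in> times T" using t by (simp add: times_def)
qed

lemma classicalD:
  assumes "classical T f" and \<tau>: "\<tau> \<in> times T"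
  shows "\<And>x t. x \<in> {0..1} \<Longrightarrow> t \<in> {0..\<tau>} \<Longrightarrow>
          ((\<lambda>y. f y t) has_real_derivative dx f x t) (at x within {0..1})"
    and "\<And>x t. x \<in> {0..1} \<Longrightarrow> t \<in> {0..\<tau>} \<Longrightarrow>
          (f x has_real_derivative dt f x t) (at t within {0..\<tau>})"
    and "\<And>x t. x \<in> {0..1} \<Longrightarrow> t \<in> {0..\<tau>} \<Longrightarrow>
          ((\<lambda>y. dx f y t) has_real_derivative dx (dx f) x t) (at x within {0..1})"
    and "\<And>x t. x \<in> {0..1} \<Longrightarrow> t \<in> {0..\<tau>} \<Longrightarrow>
          (dx f x has_real_derivative dt (dx f) x t) (at t within {0..\<tau>})"
    and "continuous_on ({0..1} \<times> {0..\<tau>}) (\<lambda>(x, t). dx f x t)"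
    and "continuous_on ({0..1} \<times> {0..\<tau>}) (\<lambda>(x, t). dt (dx f) x t)"
proof -
  have works: "(h has_real_derivative vector_derivative h (at a within A)) (at a within B)"
    if "h differentiable (at a within A)" "B \<subseteq> A" for h :: "real \<Rightarrow> real" and a A B
    using that vector_derivative_works[of h "at a within A"]
    by (auto simp: has_real_derivative_iff_has_vector_derivative intro: has_vector_derivative_within_subset)
  fix x t :: real assume x: "x \<in> {0..1}" and t: "t \<in> {0..\<tau>}"
  then have t': "t \<in> times T" using Icc_subset_times[OF \<tau>] by auto
  note C = assms(1)[unfolded classical_def, THEN conjunct1, rule_format, OF x t']
  show "((\<lambda>y. f y t) has_real_derivative dx f x t) (at x within {0..1})"
    "((\<lambda>y. dx f y t) has_real_derivative dx (dx f) x t) (at x within {0..1})"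
    using C works[where A = "{0..1}"] by (auto simp: dx_def deriv01_def)
  show "(f x has_real_derivative dt f x t) (at t within {0..\<tau>})"
    "(dx f x has_real_derivative dt (dx f) x t) (at t within {0..\<tau>})"
    using C works[where A = "{0..}" and B = "{0..\<tau>}"] by (auto simp: dt_def)
next
  have "{0..1} \<times> {0..\<tau>} \<subseteq> {0..1::real} \<times> times T"
    using Icc_subset_times[OF \<tau>] by blast
  moreover have "continuous_on ({0..1} \<times> times T) (\<lambda>(x, t). dx f x t)"
    "continuous_on ({0..1} \<times> times T) (\<lambda>(x, t). dt (dx f) x t)"
    using assms(1) by (auto simp: classical_def)
  ultimately show "continuous_on ({0..1} \<times> {0..\<tau>}) (\<lambda>(x, t). dx f x t)"
    "continuous_on ({0..1} \<times> {0..\<tau>}) (\<lambda>(x, t). dt (dx f) x t)"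
    by (auto intro: continuous_on_subset)
qed

text \<open>
  The arguments take place on compact rectangles \<open>[0, 1] \<times> [0, \<tau>]\<close>, where continuous functions can
  be integrated. The requirement \<open>\<tau> > 0\<close> makes time derivatives within \<open>[0, \<tau>]\<close> unique.
\<close>

locale transported_field =
  fixes bc :: boundary and T :: ereal and u0 b0 :: "real \<Rightarrow> real"
    and u b p :: "real \<Rightarrow> real \<Rightarrow> real" and \<tau> :: real
  assumes sol: "solution (- 1 / 2) 0 bc T u0 b0 u b p"
    and \<tau>: "\<tau> \<in> times T" "0 < \<tau>"
begin

lemmas u_regular = classicalD[OF sol[unfolded solution_def, THEN conjunct1] \<tau>(1)]
lemmas b_regular = classicalD[OF sol[unfolded solution_def, THEN conjunct2, THEN conjunct1] \<tau>(1)]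

lemma times: "t \<in> {0..\<tau>} \<Longrightarrow> t \<in> times T"
  using Icc_subset_times[OF \<tau>(1)] by blast

lemma dirichlet:
  assumes "bc = Dirichlet" "t \<in> {0..\<tau>}"
  shows "u 0 t = 0" "u 1 t = 0"
  using sol times[OF assms(2)] assms(1) by (auto simp: solution_def)

lemma periodic:
  assumes "bc = Periodic" "t \<in> {0..\<tau>}"
  shows "u 0 t = u 1 t" "dx u 0 t = dx u 1 t" "dx b 0 t = dx b 1 t"
  using sol times[OF assms(2)] assms(1) by (auto simp: solution_def)

definition energy :: "real \<Rightarrow> real" where
  "energy t = (L2_norm (\<lambda>x. dx u x t))\<^sup>2 + (L2_norm (\<lambda>x. dx b x t))\<^sup>2"

lemma dt_dx_u:
  assumes "x \<in> {0..1}" "t \<in> {0..\<tau>}"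
  shows "dt (dx u) x t + u x t * dx (dx u) x t =
    ((dx b x t)\<^sup>2 - (dx u x t)\<^sup>2 - energy t) / 2"
proof -
  have "dt (dx u) x t + u x t * dx (dx u) x t =
      (- 1 / 2) * (dx u x t)\<^sup>2 - (- 1 / 2) * (dx b x t)\<^sup>2 + 0 * b x t * dx (dx b) x t
      + I_term (- 1 / 2) 0 u b t"
    using sol assms(1) times[OF assms(2)] unfolding solution_def by blast
  then show ?thesis by (simp add: I_term_def energy_def field_simps)
qed

text \<open>
  The transport equation \<open>b\<^sub>t = - u b\<^sub>x\<close> differentiated in \<open>x\<close>.
\<close>

lemma dt_dx_b:
  assumes x: "x \<in> {0..1}" and t: "t \<in> {0..\<tau>}"
  shows "dt (dx b) x t + u x t * dx (dx b) x t = - dx u x t * dx b x t"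
proof -
  have b: "dt b y t = - u y t * dx b y t" if "y \<in> {0..1}" for y
  proof -
    have "dt b y t + u y t * dx b y t = 0 * b y t * dx u y t"
      using sol that times[OF t] unfolding solution_def by blast
    then show ?thesis by simp
  qed
  have "((\<lambda>y. - u y t * dx b y t) has_real_derivative
      - (dx u x t * dx b x t + u x t * dx (dx b) x t)) (at x within {0..1})"
    using u_regular(1)[OF x t] b_regular(3)[OF x t] by (auto intro!: derivative_eq_intros)
  then have "((\<lambda>y. dt b y t) has_real_derivative
      - (dx u x t * dx b x t + u x t * dx (dx b) x t)) (at x within {0..1})"
    by (rule has_field_derivative_transform_within[where d = 1]) (use x b in auto)
  moreover have "((\<lambda>y. dt b y t) has_real_derivative dt (dx b) x t) (at x within {0..1})"
    by (rule mixed_partials_commute[OF \<tau>(2) b_regular(1,2,4,5,6) x t])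
  moreover have "at x within {0..1} \<noteq> bot"
    using x by (simp add: trivial_limit_within)
  ultimately have "dt (dx b) x t = - (dx u x t * dx b x t + u x t * dx (dx b) x t)"
    using has_field_derivative_unique by blast
  then show ?thesis by simp
qed

lemma continuous_on_time_slice:
  assumes "continuous_on ({0..1} \<times> {0..\<tau>}) (\<lambda>(x, t). f x t)" and "t \<in> {0..\<tau>}"
  shows "continuous_on {0..1} (\<lambda>x. f x t :: real)"
  by (rule continuous_on_compose2[OF assms(1), where f = "\<lambda>x. (x, t)", simplified])
    (use assms(2) in \<open>auto intro!: continuous_intros\<close>)

lemma energy_eq_integral:
  assumes t: "t \<in> {0..\<tau>}"
  shows "energy t = integral {0..1} (\<lambda>x. (dx u x t)\<^sup>2 + (dx b x t)\<^sup>2)"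
proof -
  have L2: "(L2_norm f)\<^sup>2 = integral {0..1} (\<lambda>x. (f x)\<^sup>2)"
    "(\<lambda>x. (f x)\<^sup>2) integrable_on {0..1}"
    if "continuous_on {0..1} f" for f :: "real \<Rightarrow> real"
  proof -
    have "set_integrable lborel {0..1} (\<lambda>x. (f x)\<^sup>2)"
      by (rule borel_integrable_atLeastAtMost') (intro continuous_intros that)
    note * = set_borel_integral_eq_integral[OF this]
    show "(\<lambda>x. (f x)\<^sup>2) integrable_on {0..1}" by (rule *(1))
    then show "(L2_norm f)\<^sup>2 = integral {0..1} (\<lambda>x. (f x)\<^sup>2)"
      unfolding L2_norm_def *(2) by (simp add: integral_nonneg)
  qed
  note cont = continuous_on_time_slice[OF u_regular(5) t] continuous_on_time_slice[OF b_regular(5) t]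
  show ?thesis
    unfolding energy_def L2(1)[OF cont(1)] L2(1)[OF cont(2)]
    by (rule integral_add[symmetric]) (intro L2(2) cont)+
qed

text \<open>
  The cubic terms exchanged between \<open>u\<^sub>x\<^sup>2\<close> and \<open>b\<^sub>x\<^sup>2\<close> combine with the transport terms to a
  divergence, and the remaining \<open>- E u\<^sub>x\<close> is one as well.
\<close>

lemma energy_conserved:
  assumes t: "t \<in> {0..\<tau>}"
  shows "energy t = energy 0"
proof -
  let ?e = "\<lambda>x s. (dx u x s)\<^sup>2 + (dx b x s)\<^sup>2"
  let ?et = "\<lambda>x s. 2 * dx u x s * dt (dx u) x s + 2 * dx b x s * dt (dx b) x s"
  have deriv: "(energy has_real_derivative 0) (at s within {0..\<tau>})" if s: "s \<in> {0..\<tau>}" for s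
  proof -
    have swap: "continuous_on ({0..\<tau>} \<times> cbox 0 1) (\<lambda>(s, x). f x s)"
      if "continuous_on ({0..1} \<times> {0..\<tau>}) (\<lambda>(x, s). f x s)" for f :: "real \<Rightarrow> real \<Rightarrow> real"
      unfolding split_beta
      by (rule continuous_on_compose2[OF that, where f = "\<lambda>p. (snd p, fst p)", simplified])
        (auto intro!: continuous_intros)
    have "((\<lambda>s. integral (cbox 0 1) (\<lambda>x. ?e x s)) has_real_derivative
        integral (cbox 0 1) (\<lambda>x. ?et x s)) (at s within {0..\<tau>})"
    proof (rule leibniz_rule_field_derivative[OF _ _ _ s])
      show "((\<lambda>r. ?e x r) has_real_derivative ?et x r) (at r within {0..\<tau>})"
        if "r \<in> {0..\<tau>}" "x \<in> cbox 0 1" for r x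
        using that u_regular(4)[of x r] b_regular(4)[of x r] by (auto intro!: derivative_eq_intros)
      show "(\<lambda>x. ?e x r) integrable_on cbox 0 1" if "r \<in> {0..\<tau>}" for r
        using continuous_on_time_slice[OF u_regular(5) that] continuous_on_time_slice[OF b_regular(5) that]
        by (intro integrable_continuous) (auto intro!: continuous_intros)
      show "continuous_on ({0..\<tau>} \<times> cbox 0 1) (\<lambda>(r, x). ?et x r)"
        using swap[OF u_regular(5)] swap[OF u_regular(6)] swap[OF b_regular(5)] swap[OF b_regular(6)]
        unfolding split_beta by (intro continuous_intros)
    qed simp
    moreover
    let ?flux = "\<lambda>x. - u x s * ?e x s - energy s * u x s"
    have "(?et x s) = - dx u x s * ?e x s
        - u x s * (2 * dx u x s * dx (dx u) x s + 2 * dx b x s * dx (dx b) x s)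
        - energy s * dx u x s" if x: "x \<in> {0..1}" for x
    proof -
      have uxt: "dt (dx u) x s = ((dx b x s)\<^sup>2 - (dx u x s)\<^sup>2 - energy s) / 2
          - u x s * dx (dx u) x s"
        using dt_dx_u[OF x s] by linarith
      have bxt: "dt (dx b) x s = - dx u x s * dx b x s - u x s * dx (dx b) x s"
        using dt_dx_b[OF x s] by simp
      show ?thesis unfolding uxt bxt
        by (simp add: algebra_simps power2_eq_square add_divide_distrib diff_divide_distrib)
    qed
    then have "(?flux has_real_derivative ?et x s) (at x within {0..1})" if "x \<in> {0..1}" for x
      using that u_regular(1)[OF that s] u_regular(3)[OF that s] b_regular(3)[OF that s]
      by (auto intro!: derivative_eq_intros simp: algebra_simps)
    then have "((\<lambda>x. ?et x s) has_integral (?flux 1 - ?flux 0)) {0..1}"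
      by (intro fundamental_theorem_of_calculus)
        (auto simp: has_real_derivative_iff_has_vector_derivative[symmetric])
    moreover have "?flux 1 = ?flux 0"
      using dirichlet[OF _ s] periodic[OF _ s] by (cases bc) auto
    ultimately have "((\<lambda>s. integral {0..1} (\<lambda>x. ?e x s)) has_real_derivative 0)
        (at s within {0..\<tau>})"
      by (simp add: integral_unique)
    then show ?thesis
      by (rule has_field_derivative_transform_within[where d = 1])
        (use s energy_eq_integral in auto)
  qed
  then obtain c where "\<forall>s\<in>{0..\<tau>}. energy s = c"
    using has_field_derivative_zero_constant[of "{0..\<tau>}" energy] by auto
  then have "energy t = c" "energy 0 = c" using t by auto
  then show ?thesis by simp
qed

text \<open>
  Since \<open>W = U\<^sup>2 + B\<^sup>2 + E\<close> and \<open>B\<close> solve the same linear equation \<open>y' = - U y\<close>, their ratio is the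
  constant \<open>C\<close> on the right-hand side. From \<open>U\<^sup>2 + B\<^sup>2 \<le> C B\<close> follows first \<open>B \<le> C\<close>, then \<open>U\<^sup>2 \<le> C\<^sup>2\<close>.
  The bound does not depend on \<open>\<tau>\<close>.
\<close>

lemma trajectory_bound:
  fixes g :: "real \<Rightarrow> real"
  defines "U \<equiv> \<lambda>s. value_at bc (dx u) (g s) s" and "B \<equiv> \<lambda>s. value_at bc (dx b) (g s) s"
  assumes g: "\<And>s. s \<in> {0..\<tau>} \<Longrightarrow>
        (g has_real_derivative value_at bc u (g s) s) (at s within {0..\<tau>})"
    and dir: "\<And>s. bc = Dirichlet \<Longrightarrow> s \<in> {0..\<tau>} \<Longrightarrow> g s \<in> {0..1}"
    and B0: "B 0 > 0"
    and t: "t \<in> {0..\<tau>}"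
  shows "\<bar>U t\<bar> \<le> ((U 0)\<^sup>2 + (B 0)\<^sup>2 + energy 0) / B 0"
    and "\<bar>B t\<bar> \<le> ((U 0)\<^sup>2 + (B 0)\<^sup>2 + energy 0) / B 0"
proof -
  let ?W = "\<lambda>s. (U s)\<^sup>2 + (B s)\<^sup>2 + energy 0"
  have U': "(U has_real_derivative ((B s)\<^sup>2 - (U s)\<^sup>2 - energy 0) / 2) (at s within {0..\<tau>})"
    and B': "(B has_real_derivative - U s * B s) (at s within {0..\<tau>})"
    if s: "s \<in> {0..\<tau>}" for s
  proof -
    let ?D = "\<lambda>x s. ((dx b x s)\<^sup>2 - (dx u x s)\<^sup>2 - energy 0) / 2"
    have "((\<lambda>s. value_at bc (dx u) (g s) s) has_real_derivative value_at bc ?D (g s) s)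
        (at s within {0..\<tau>})"
    proof (rule material_derivative[where Fx = "dx (dx u)" and Ft = "dt (dx u)" and u = u])
      show "((dx b x s)\<^sup>2 - (dx u x s)\<^sup>2 - energy 0) / 2 = dt (dx u) x s + u x s * dx (dx u) x s" if "x \<in> {0..1}" for x
        using dt_dx_u[OF that s] energy_conserved[OF s] by simp
      show "((\<lambda>y. dx u y s) has_real_derivative dx (dx u) x s) (at x within {0..1})"
        if "x \<in> {0..1}" for x
        using u_regular(3)[OF that s] .
      show "(dx u x has_real_derivative dt (dx u) x r) (at r within {0..\<tau>})"
        if "x \<in> {0..1}" "r \<in> {0..\<tau>}" for x r
        using u_regular(4)[OF that] .
      show "((dx b 0 s)\<^sup>2 - (dx u 0 s)\<^sup>2 - energy 0) / 2 = ((dx b 1 s)\<^sup>2 - (dx u 1 s)\<^sup>2 - energy 0) / 2" if "bc = Periodic"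
        using periodic[OF that s] by simp
    qed (use s u_regular(6) g[OF s] dir periodic in blast)+
    moreover have "value_at bc ?D (g s) s = ((B s)\<^sup>2 - (U s)\<^sup>2 - energy 0) / 2"
      unfolding U_def B_def by (cases bc) auto
    ultimately show "(U has_real_derivative ((B s)\<^sup>2 - (U s)\<^sup>2 - energy 0) / 2)
        (at s within {0..\<tau>})"
      unfolding U_def by simp
    let ?D = "\<lambda>x s. - dx u x s * dx b x s"
    have "((\<lambda>s. value_at bc (dx b) (g s) s) has_real_derivative value_at bc ?D (g s) s)
        (at s within {0..\<tau>})"
    proof (rule material_derivative[where Fx = "dx (dx b)" and Ft = "dt (dx b)" and u = u])
      show "- dx u x s * dx b x s = dt (dx b) x s + u x s * dx (dx b) x s" if "x \<in> {0..1}" for x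
        using dt_dx_b[OF that s] by simp
      show "((\<lambda>y. dx b y s) has_real_derivative dx (dx b) x s) (at x within {0..1})"
        if "x \<in> {0..1}" for x
        using b_regular(3)[OF that s] .
      show "(dx b x has_real_derivative dt (dx b) x r) (at r within {0..\<tau>})"
        if "x \<in> {0..1}" "r \<in> {0..\<tau>}" for x r
        using b_regular(4)[OF that] .
      show "- dx u 0 s * dx b 0 s = - dx u 1 s * dx b 1 s" if "bc = Periodic"
        using periodic[OF that s] by simp
    qed (use s b_regular(6) g[OF s] dir periodic in blast)+
    moreover have "value_at bc ?D (g s) s = - U s * B s"
      unfolding U_def B_def by (cases bc) auto
    ultimately show "(B has_real_derivative - U s * B s) (at s within {0..\<tau>})"
      unfolding B_def by simp
  qed
  have W': "(?W has_real_derivative - U s * ?W s) (at s within {0..\<tau>})"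
    if s: "s \<in> {0..\<tau>}" for s
  proof -
    have "(?W has_real_derivative
        2 * U s * (((B s)\<^sup>2 - (U s)\<^sup>2 - energy 0) / 2) + 2 * B s * (- U s * B s))
        (at s within {0..\<tau>})"
      using U'[OF s] B'[OF s] by (auto intro!: derivative_eq_intros)
    also have "2 * U s * (((B s)\<^sup>2 - (U s)\<^sup>2 - energy 0) / 2) + 2 * B s * (- U s * B s)
        = - U s * ?W s"
      by (simp add: field_simps power2_eq_square)
    finally show ?thesis .
  qed
  have "continuous_on {0..\<tau>} (\<lambda>s. - U s)"
    using U' by (intro continuous_intros DERIV_continuous_on)
  from linear_ode_exp[OF this W' t] linear_ode_exp[OF this B' t]
  have ratio: "?W t = ?W 0 / B 0 * B t"
    using B0 by (simp only:) simp
  define C where "C = ?W 0 / B 0"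
  have "energy 0 \<ge> 0" by (simp add: energy_def)
  then have C: "C \<ge> 0" using B0 by (simp add: C_def)
  have le: "(U t)\<^sup>2 + (B t)\<^sup>2 \<le> C * B t"
    using ratio \<open>energy 0 \<ge> 0\<close> by (simp add: C_def)
  have B_le: "\<bar>B t\<bar> \<le> C"
  proof (rule ccontr)
    assume "\<not> \<bar>B t\<bar> \<le> C"
    then have "C * \<bar>B t\<bar> < \<bar>B t\<bar> * \<bar>B t\<bar>" using C by (intro mult_strict_right_mono) auto
    also have "\<dots> \<le> (U t)\<^sup>2 + (B t)\<^sup>2" by (simp add: power2_eq_square)
    also have "\<dots> \<le> C * \<bar>B t\<bar>"
      using le C by (meson abs_ge_self mult_left_mono order_trans)
    finally show False by simp
  qed
  then show "\<bar>B t\<bar> \<le> ((U 0)\<^sup>2 + (B 0)\<^sup>2 + energy 0) / B 0" by (simp add: C_def)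
  have "(U t)\<^sup>2 \<le> C * B t" using le by (smt (verit) zero_le_power2)
  also have "\<dots> \<le> C * C" using B_le C by (intro mult_left_mono) auto
  finally have "\<bar>U t\<bar> \<le> C" using C abs_le_square_iff[of "U t" C] by (simp add: power2_eq_square)
  then show "\<bar>U t\<bar> \<le> ((U 0)\<^sup>2 + (B 0)\<^sup>2 + energy 0) / B 0" by (simp add: C_def)
qed

end

lemma bounded_not_blows_up:
  assumes "\<And>t. 0 < t \<Longrightarrow> t \<in> times T \<Longrightarrow> \<bar>f t\<bar> \<le> C"
  shows "\<not> blows_up_in_finite_time T f"
proof
  assume "blows_up_in_finite_time T f"
  then obtain ts where ts: "ts > 0" "ereal ts \<le> T"
    and lim: "Limsup (at_left ts) (\<lambda>t. ereal \<bar>f t\<bar>) = \<infinity>"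
    unfolding blows_up_in_finite_time_def by blast
  have "\<forall>\<^sub>F t in at_left ts. t \<in> {0<..<ts}"
    using ts(1) by (rule eventually_at_leftI[rotated]) simp
  then have "\<forall>\<^sub>F t in at_left ts. ereal \<bar>f t\<bar> \<le> ereal C"
  proof eventually_elim
    case (elim t)
    then have "ereal t < ereal ts" by simp
    also note ts(2)
    finally show ?case using elim by (simp add: assms times_def)
  qed
  then have "Limsup (at_left ts) (\<lambda>t. ereal \<bar>f t\<bar>) \<le> ereal C"
    by (rule Limsup_bounded)
  with lim show False by simp
qed

theorem theorem7p1:
  fixes u b p \<gamma> :: "real \<Rightarrow> real \<Rightarrow> real"
    and u0 b0 :: "real \<Rightarrow> real"
    and lam kap \<alpha>0 :: real
    and T :: ereal
    and bc :: boundary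
  assumes "0 < T"
    and "smooth01 u0" and "smooth01 b0"
    and "solution lam kap bc T u0 b0 u b p"
    and "lagrangian_trajectories bc T u \<gamma>"
    and "\<alpha>0 \<in> {0..1}" and "b0 \<alpha>0 = 0" and "deriv01 b0 \<alpha>0 > 0"
    and "\<exists>x\<in>{0..1}. u0 x \<noteq> 0 \<or> b0 x \<noteq> 0"
    and "(L2_norm (deriv01 u0))\<^sup>2 + (L2_norm (deriv01 b0))\<^sup>2 \<le> 1"
    and "(lam, kap) = (- 1 / 2, 0)"
  shows "\<not> blows_up_in_finite_time T (\<lambda>t. value_at bc (dx u) (\<gamma> \<alpha>0 t) t) \<and>
         \<not> blows_up_in_finite_time T (\<lambda>t. value_at bc (dx b) (\<gamma> \<alpha>0 t) t)"
proof -
  let ?U = "\<lambda>t. value_at bc (dx u) (\<gamma> \<alpha>0 t) t" and ?B = "\<lambda>t. value_at bc (dx b) (\<gamma> \<alpha>0 t) t"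
  let ?C = "((?U 0)\<^sup>2 + (?B 0)\<^sup>2 + transported_field.energy u b 0) / ?B 0"
  have sol: "solution (- 1 / 2) 0 bc T u0 b0 u b p" using assms(4,11) by simp
  have zero: "0 \<in> times T" using assms(1) by (simp add: times_def zero_ereal_def)
  note traj = assms(5)[unfolded lagrangian_trajectories_def, rule_format, OF assms(6)]
  have "dx b \<alpha>0 0 = deriv01 b0 \<alpha>0"
  proof -
    have eq: "b y 0 = b0 y" if "y \<in> {0..1}" for y
      using sol that by (simp add: solution_def)
    have "((\<lambda>y. b y 0) has_vector_derivative D) (at \<alpha>0 within {0..1}) \<longleftrightarrow>
        (b0 has_vector_derivative D) (at \<alpha>0 within {0..1})" for D
    proof
      show "(b0 has_vector_derivative D) (at \<alpha>0 within {0..1})"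
        if "((\<lambda>y. b y 0) has_vector_derivative D) (at \<alpha>0 within {0..1})"
        by (rule has_vector_derivative_transform[OF assms(6) _ that]) (rule eq[symmetric])
      show "((\<lambda>y. b y 0) has_vector_derivative D) (at \<alpha>0 within {0..1})"
        if "(b0 has_vector_derivative D) (at \<alpha>0 within {0..1})"
        by (rule has_vector_derivative_transform[OF assms(6) _ that]) (rule eq)
    qed
    then show ?thesis by (simp add: dx_def deriv01_def vector_derivative_def)
  qed
  moreover have "?B 0 = dx b \<alpha>0 0"
  proof (cases bc)
    case Dirichlet
    then show ?thesis using traj by simp
  next
    case Periodic
    then have "dx b 0 0 = dx b 1 0" using sol zero by (simp add: solution_def)
    then show ?thesis
      using value_at_periodic[of "dx b" 0 \<alpha>0 0] assms(6) traj Periodic by simp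
  qed
  ultimately have B0: "?B 0 > 0" using assms(8) by simp
  have bound: "\<bar>?U t\<bar> \<le> ?C" "\<bar>?B t\<bar> \<le> ?C" if t: "0 < t" "t \<in> times T" for t
  proof -
    interpret transported_field bc T u0 b0 u b p t
      using sol t by unfold_locales
    have *: "(\<gamma> \<alpha>0 has_real_derivative value_at bc u (\<gamma> \<alpha>0 s) s) (at s within {0..t})"
      if "s \<in> {0..t}" for s
      using traj times[OF that] by (auto intro: has_field_derivative_subset)
    have "\<gamma> \<alpha>0 s \<in> {0..1}" if "bc = Dirichlet" "s \<in> {0..t}" for s
      using traj that times[OF that(2)] by blast
    from trajectory_bound[OF * this B0, of t] t show "\<bar>?U t\<bar> \<le> ?C" "\<bar>?B t\<bar> \<le> ?C"
      by auto
  qed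
  show ?thesis
    by (rule conjI; rule bounded_not_blows_up[where C = ?C]; rule bound)
qed

end
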